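(* Let $\Lambda=\delta_{1/2}-\delta_0$ be the bounded linear functional on $C([0,1],\mathbb{C})$ given by $\Lambda f=f(\tfrac12)-f(0)$. Let $\mathcal{E}=\ker\Lambda=\{f\in C([0,1],\mathbb{C}) : f(0)=f(\tfrac12)\}$, let $\mathcal{F}=\{u\in \mathcal{E}\cap\mathcal{D} : u'\in \mathcal{E}\}$, where $\mathcal{D}$ is the space of continuously differentiable functions $[0,1]\to\mathbb{C}$, and let $T:\mathcal{F}\to \mathcal{E}$, $Tu=u'$. Then $\mathcal{E}$ is closed and $$\sigma(T)=4i\pi\mathbb{Z}=\{4i\pi n : n\in\mathbb{Z}\}.$$ For $f\in \mathcal{E}$, $\zeta\in\rho(T)$ and $x\in[0,1]$, $$R_T(\zeta)f(x)=\frac{e^{\zeta x}}{e^{\zeta/2}-1}\,K_\zeta f\left(\tfrac12\right)-K_\zeta f(x).$$ Moreover, for every real $\zeta>0$ (hence $\zeta\in\rho(T)$) there exists $f\in \mathcal{E}$ such that: (i) $f(0)=f(\tfrac12)=0$; (ii) $\|f\|_\infty=e^{\zeta/2}$; (iii) $K_\zeta f(\tfrac12)=0$; (iv) for every $x\in[0,1]$, $R_T(\zeta)f(x)=-K_\zeta f(x)$; (v) $R_T(\zeta)f(1)=e^{\zeta/2}\left(\frac1\zeta+\frac{2}{\zeta^2}\right)-\frac{2e^\zeta}{\zeta^2}$. Therefore, for every real $\zeta>0$, $$\|R_T(\zeta)\|\ge\frac{2e^{\zeta/2}}{\zeta^2}-\frac1\zeta-\frac{2}{\zeta^2},$$ and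 $\|R_T(\zeta)\|\to+\infty$ as $\zeta\to+\infty$ along the positive reals.
   Context: $C([0,1],\mathbb{C})$ carries the sup norm $\|f\|_\infty=\max_{x\in[0,1]}|f(x)|$. Functions in $\mathcal{D}$ are right-differentiable at $0$ and left-differentiable at $1$, with continuous derivative on $[0,1]$. For $\zeta\in\mathbb{C}$ and $f\in C([0,1],\mathbb{C})$, $K_\zeta f(x)=e^{\zeta x}\int_0^x e^{-\zeta t}f(t)\,dt$ for $x\in[0,1]$. A linear map $T:\mathcal{F}\to \mathcal{E}$ from a linear subspace $\mathcal{F}$ of a complex Banach space $\mathcal{E}$ is a closed operator if whenever $u_n\in \mathcal{F}$, $u_n\to u$ in $\mathcal{E}$ and $Tu_n\to v$ in $\mathcal{E}$, then $u\in \mathcal{F}$ and $v=Tu$; then $\mathcal{F}$ with the norm $N_1^T(u)=\|u\|+\|Tu\|$ is a Banach space. Let $J:\mathcal{F}\to \mathcal{E}$ be the canonical injection. For a closed $T$ (as is the case here), $\zeta\in\mathbb{C}$ is in the resolvent set $\rho(T)$ if $\zeta J-T:\mathcal{F}\to \mathcal{E}$ has an inverse that is a bounded linear map from $\mathcal{E}$ to $(\mathcal{F},N_1^T)$; this inverse is denoted $R_T(\zeta)$, and $\sigma(T)=\mathbb{C}\setminus\rho(T)$. The norm $\|R_T(\zeta)\|$ in this statement is the operator norm with both $\mathcal{E}$ and $\mathcal{F}$ carrying the sup norm $\|\cdot\|_\infty$. *)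

theory Defs
  imports "HOL-Analysis.Analysis"
begin

section \<open>Complex normed spaces\<close>

class complex_normed_vector = real_normed_vector +
  fixes scaleC :: "complex \<Rightarrow> 'a \<Rightarrow> 'a"  (infixr \<open>*\<^sub>C\<close> 75)
  assumes scaleC_add_right: "a *\<^sub>C (x + y) = a *\<^sub>C x + a *\<^sub>C y"
    and scaleC_add_left: "(a + b) *\<^sub>C x = a *\<^sub>C x + b *\<^sub>C x"
    and scaleC_scaleC: "a *\<^sub>C b *\<^sub>C x = (a * b) *\<^sub>C x"
    and scaleC_of_real: "complex_of_real r *\<^sub>C x = r *\<^sub>R x"
    and norm_scaleC: "norm (a *\<^sub>C x) = cmod a * norm x"

class complex_banach = complex_normed_vector + banach

lemma vector_space_scaleC:
  "vector_space (scaleC :: complex \<Rightarrow> 'a \<Rightarrow> 'a::complex_normed_vector)"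
proof
  show "1 *\<^sub>C x = x" for x :: 'a
    using scaleC_of_real[of 1 x] by simp
qed (simp_all add: scaleC_add_right scaleC_add_left scaleC_scaleC)

abbreviation csubspace :: "'a::complex_normed_vector set \<Rightarrow> bool"
  where "csubspace \<equiv> module.subspace scaleC"

definition clinear_on ::
    "'a set \<Rightarrow> ('a::complex_normed_vector \<Rightarrow> 'b::complex_normed_vector) \<Rightarrow> bool"
  where "clinear_on V L \<longleftrightarrow>
    (\<forall>u\<in>V. \<forall>v\<in>V. L (u + v) = L u + L v) \<and> (\<forall>c. \<forall>u\<in>V. L (c *\<^sub>C u) = c *\<^sub>C L u)"

instantiation complex :: complex_banach
begin

definition scaleC_complex :: "complex \<Rightarrow> complex \<Rightarrow> complex"
  where "scaleC_complex a x = a * x"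

instance
  by standard (simp_all add: scaleC_complex_def algebra_simps norm_mult scaleR_conv_of_real)

end

section \<open>Closed operators, resolvent and spectrum\<close>

text \<open>A Banach space \<open>E\<close> is given as a closed complex subspace of a type of class
  \<^class>\<open>complex_banach\<close>; an operator with domain \<open>F \<subseteq> E\<close> is a function on the
  type of which only the values on \<open>F\<close> matter.\<close>

definition closed_operator ::
    "'a::complex_banach set \<Rightarrow> 'a set \<Rightarrow> ('a \<Rightarrow> 'a) \<Rightarrow> bool"
  where "closed_operator E F T \<longleftrightarrow>
    csubspace E \<and> closed E \<and> csubspace F \<and> F \<subseteq> E \<and> clinear_on F T \<and> T ` F \<subseteq> E \<and>
    (\<forall>w u v. (\<forall>n::nat. w n \<in> F) \<longrightarrow> u \<in> E \<longrightarrow> v \<in> E \<longrightarrow>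
       w \<longlonglongrightarrow> u \<longrightarrow> (\<lambda>n. T (w n)) \<longlonglongrightarrow> v \<longrightarrow> u \<in> F \<and> v = T u)"

definition graph_norm :: "('a::complex_banach \<Rightarrow> 'a) \<Rightarrow> 'a \<Rightarrow> real"
  where "graph_norm T u = norm u + norm (T u)"

text \<open>The inverse of \<open>\<zeta>J - T : F \<rightarrow> E\<close>; meaningful for arguments in \<open>E\<close> when that map
  is bijective.\<close>

definition resolvent ::
    "'a::complex_banach set \<Rightarrow> ('a \<Rightarrow> 'a) \<Rightarrow> complex \<Rightarrow> 'a \<Rightarrow> 'a"
  where "resolvent F T \<zeta> = inv_into F (\<lambda>u. \<zeta> *\<^sub>C u - T u)"

definition resolvent_set ::
    "'a::complex_banach set \<Rightarrow> 'a set \<Rightarrow> ('a \<Rightarrow> 'a) \<Rightarrow> complex set"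
  where "resolvent_set E F T = {\<zeta>.
    bij_betw (\<lambda>u. \<zeta> *\<^sub>C u - T u) F E \<and>
    clinear_on E (resolvent F T \<zeta>) \<and>
    (\<exists>C. \<forall>f\<in>E. graph_norm T (resolvent F T \<zeta> f) \<le> C * norm f)}"

definition spectrum ::
    "'a::complex_banach set \<Rightarrow> 'a set \<Rightarrow> ('a \<Rightarrow> 'a) \<Rightarrow> complex set"
  where "spectrum E F T = - resolvent_set E F T"

text \<open>Operator norm of a map on the subspace \<open>E\<close>, with the ambient norm on both sides;
  the analogue of \<^const>\<open>onorm\<close>, including the convention \<open>x / 0 = 0\<close>.\<close>

definition onorm_on ::
    "'a::complex_banach set \<Rightarrow> ('a \<Rightarrow> 'a) \<Rightarrow> real"
  where "onorm_on E S = (SUP f\<in>E. norm (S f) / norm f)"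

section \<open>The space of continuous complex functions on the unit interval\<close>

typedef unit_interval = "{0..1::real}"
  by (rule exI[of _ 0]) simp

instantiation unit_interval :: metric_space
begin

definition dist_unit_interval :: "unit_interval \<Rightarrow> unit_interval \<Rightarrow> real"
  where "dist_unit_interval x y = dist (Rep_unit_interval x) (Rep_unit_interval y)"

definition uniformity_unit_interval :: "(unit_interval \<times> unit_interval) filter"
  where "uniformity_unit_interval = (INF e\<in>{0<..}. principal {(x, y). dist x y < e})"

definition open_unit_interval :: "unit_interval set \<Rightarrow> bool"
  where "open_unit_interval S = (\<forall>x\<in>S. \<forall>\<^sub>F (x', y) in uniformity. x' = x \<longrightarrow> y \<in> S)"

instance
  by standard
    (auto simp: dist_unit_interval_def uniformity_unit_interval_def open_unit_interval_def
      Rep_unit_interval_inject dist_triangle2)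

end

instantiation bcontfun :: (topological_space, complex_normed_vector) complex_normed_vector
begin

definition scaleC_bcontfun :: "complex \<Rightarrow> ('a \<Rightarrow>\<^sub>C 'b) \<Rightarrow> 'a \<Rightarrow>\<^sub>C 'b"
  where "scaleC_bcontfun c f = Bcontfun (\<lambda>x. c *\<^sub>C apply_bcontfun f x)"

lemma apply_scaleC_bcontfun:
  fixes f :: "'a \<Rightarrow>\<^sub>C 'b"
  shows "apply_bcontfun (c *\<^sub>C f) x = c *\<^sub>C apply_bcontfun f x"
proof -
  have lin: "bounded_linear (\<lambda>y::'b. c *\<^sub>C y)"
  proof (rule bounded_linear_intro[where K = "cmod c"])
    fix r :: real and y :: 'b
    show "c *\<^sub>C (r *\<^sub>R y) = r *\<^sub>R (c *\<^sub>C y)"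
      by (simp add: scaleC_of_real[symmetric] scaleC_scaleC mult.commute)
  qed (simp_all add: scaleC_add_right norm_scaleC mult.commute)
  have "(\<lambda>x. c *\<^sub>C apply_bcontfun f x) \<in> bcontfun"
    unfolding bcontfun_def
  proof (intro CollectI conjI)
    show "continuous_on UNIV (\<lambda>x. c *\<^sub>C apply_bcontfun f x)"
      by (rule bounded_linear.continuous_on[OF lin]) simp
    show "bounded (range (\<lambda>x. c *\<^sub>C apply_bcontfun f x))"
      using bounded_linear_image[OF bounded_apply_bcontfun[of f] lin]
      by (simp add: image_image)
  qed
  then show ?thesis
    by (simp add: scaleC_bcontfun_def Bcontfun_inverse)
qed

instance
proof
  fix a b :: complex and r :: real and x y :: "'a \<Rightarrow>\<^sub>C 'b"
  show "a *\<^sub>C (x + y) = a *\<^sub>C x + a *\<^sub>C y"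
    by (rule bcontfun_eqI) (simp add: apply_scaleC_bcontfun scaleC_add_right)
  show "(a + b) *\<^sub>C x = a *\<^sub>C x + b *\<^sub>C x"
    by (rule bcontfun_eqI) (simp add: apply_scaleC_bcontfun scaleC_add_left)
  show assoc: "c *\<^sub>C d *\<^sub>C z = (c * d) *\<^sub>C z" for c d and z :: "'a \<Rightarrow>\<^sub>C 'b"
    by (rule bcontfun_eqI) (simp add: apply_scaleC_bcontfun scaleC_scaleC)
  show real: "complex_of_real s *\<^sub>C z = s *\<^sub>R z" for s and z :: "'a \<Rightarrow>\<^sub>C 'b"
    by (rule bcontfun_eqI) (simp add: apply_scaleC_bcontfun scaleC_of_real)
  have le: "norm (c *\<^sub>C z) \<le> cmod c * norm z" for c and z :: "'a \<Rightarrow>\<^sub>C 'b"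
    by (rule norm_bound)
      (simp add: apply_scaleC_bcontfun norm_scaleC mult_left_mono norm_bounded)
  show "norm (a *\<^sub>C x) = cmod a * norm x"
  proof (cases "a = 0")
    case True
    then show ?thesis using le[of 0 x] by simp
  next
    case False
    have "x = inverse a *\<^sub>C a *\<^sub>C x"
      using False real[of 1 x] by (simp add: assoc)
    then have "norm x \<le> cmod (inverse a) * norm (a *\<^sub>C x)"
      using le[of "inverse a" "a *\<^sub>C x"] by simp
    then have "norm x \<le> inverse (cmod a) * norm (a *\<^sub>C x)"
      by (simp only: norm_inverse)
    then have "cmod a * norm x \<le> norm (a *\<^sub>C x)"
      using False by (simp add: field_simps)
    with le[of a x] show ?thesis by simp
  qed
qed

end

instance bcontfun :: (metric_space, complex_banach) complex_banach ..

text \<open>Since \<^typ>\<open>unit_interval\<close> is compact, all continuous functions on it are bounded, so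
  this is the whole of \<open>C([0,1],\<complex>)\<close>, and its norm is the sup norm.\<close>

type_synonym C01 = "unit_interval \<Rightarrow>\<^sub>C complex"

text \<open>The value at a real point, meaningful for points of \<open>{0..1}\<close> only.\<close>

definition ev :: "C01 \<Rightarrow> real \<Rightarrow> complex"
  where "ev f x = apply_bcontfun f (Abs_unit_interval x)"

lemma continuous_on_ev: "continuous_on {0..1} (ev f)"
proof -
  have "continuous_on {0..1} Abs_unit_interval"
    unfolding continuous_on_iff by (auto simp: dist_unit_interval_def Abs_unit_interval_inverse)
  then have "continuous_on {0..1} (\<lambda>x. apply_bcontfun f (Abs_unit_interval x))"
    by (rule continuous_on_compose2[OF continuous_on_apply_bcontfun[of UNIV f]]) simp
  then show ?thesis
    by (simp add: ev_def[abs_def])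
qed

lemma ex1_ev_eq:
  assumes "continuous_on {0..1} g"
  shows "\<exists>!f :: C01. \<forall>x\<in>{0..1}. ev f x = g x"
proof (rule ex_ex1I)
  have rep: "continuous_on UNIV Rep_unit_interval"
    unfolding continuous_on_iff by (auto simp: dist_unit_interval_def)
  have range: "range Rep_unit_interval = {0..1}"
    using type_definition.Rep_range[OF type_definition_unit_interval] .
  have "(\<lambda>t. g (Rep_unit_interval t)) \<in> bcontfun"
    unfolding bcontfun_def
  proof (intro CollectI conjI)
    show "continuous_on UNIV (\<lambda>t. g (Rep_unit_interval t))"
      by (rule continuous_on_compose2[OF assms rep]) (simp add: range)
    have "bounded (g ` {0..1})"
      using assms compact_Icc compact_continuous_image compact_imp_bounded by blast
    then show "bounded (range (\<lambda>t. g (Rep_unit_interval t)))"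
      unfolding range[symmetric] image_image .
  qed
  then obtain f :: C01 where f: "apply_bcontfun f = (\<lambda>t. g (Rep_unit_interval t))"
    by (metis bcontfunE)
  then have "\<forall>x\<in>{0..1}. ev f x = g x"
    by (simp add: ev_def Abs_unit_interval_inverse)
  then show "\<exists>f :: C01. \<forall>x\<in>{0..1}. ev f x = g x" ..
next
  fix f h :: C01
  assume *: "\<forall>x\<in>{0..1}. ev f x = g x" "\<forall>x\<in>{0..1}. ev h x = g x"
  show "f = h"
  proof (rule bcontfun_eqI)
    fix t
    have "apply_bcontfun f t = ev f (Rep_unit_interval t)"
         "apply_bcontfun h t = ev h (Rep_unit_interval t)"
      by (simp_all add: ev_def Rep_unit_interval_inverse)
    then show "apply_bcontfun f t = apply_bcontfun h t"
      using * Rep_unit_interval[of t] by simp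
  qed
qed

section \<open>The operator\<close>

text \<open>Derivatives at the end points are one-sided. Since the derivative is itself an element
  of \<^typ>\<open>C01\<close>, it is continuous on \<open>{0..1}\<close>.\<close>

definition has_deriv01 :: "C01 \<Rightarrow> C01 \<Rightarrow> bool"
  where "has_deriv01 u v \<longleftrightarrow>
    (\<forall>x\<in>{0..1}. (ev u has_vector_derivative ev v x) (at x within {0..1}))"

definition D_space :: "C01 set"
  where "D_space = {u. \<exists>v. has_deriv01 u v}"

definition deriv01 :: "C01 \<Rightarrow> C01"
  where "deriv01 u = (THE v. has_deriv01 u v)"

lemma deriv01_eqI:
  assumes "has_deriv01 u v"
  shows "deriv01 u = v"
  unfolding deriv01_def
proof (rule the_equality)
  show "has_deriv01 u v" by (rule assms)
next
  fix w assume w: "has_deriv01 u w"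
  show "w = v"
  proof (rule bcontfun_eqI)
    fix t
    define x where "x = Rep_unit_interval t"
    have x: "x \<in> {0..1}" "t = Abs_unit_interval x"
      using Rep_unit_interval[of t] by (simp_all add: x_def Rep_unit_interval_inverse)
    have "ev w x = ev v x"
      using vector_derivative_unique_within_closed_interval[of 0 1 x "ev u" "ev w x" "ev v x"]
        w assms x(1) by (simp add: has_deriv01_def)
    then show "apply_bcontfun w t = apply_bcontfun v t"
      by (simp add: ev_def x(2))
  qed
qed

definition Lam :: "C01 \<Rightarrow> complex"
  where "Lam f = ev f (1/2) - ev f 0"

lemma Lam_bounded_clinear: "clinear_on UNIV Lam" "cmod (Lam f) \<le> 2 * norm f"
proof -
  show "clinear_on UNIV Lam"
    by (simp add: clinear_on_def Lam_def ev_def apply_scaleC_bcontfun scaleC_complex_def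
        algebra_simps)
  have "cmod (ev f x) \<le> norm f" for x
    unfolding ev_def by (rule norm_bounded)
  from this[of "1/2"] this[of 0] show "cmod (Lam f) \<le> 2 * norm f"
    using norm_triangle_ineq4[of "ev f (1/2)" "ev f 0"] by (simp add: Lam_def)
qed

definition E_space :: "C01 set"
  where "E_space = {f. Lam f = 0}"

definition F_space :: "C01 set"
  where "F_space = {u \<in> E_space \<inter> D_space. deriv01 u \<in> E_space}"

text \<open>The operator is \<^const>\<open>deriv01\<close> with domain \<^const>\<open>F_space\<close>.\<close>

abbreviation \<rho>\<^sub>T :: "complex set"
  where "\<rho>\<^sub>T \<equiv> resolvent_set E_space F_space deriv01"

abbreviation \<sigma>\<^sub>T :: "complex set"
  where "\<sigma>\<^sub>T \<equiv> spectrum E_space F_space deriv01"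

abbreviation R\<^sub>T :: "complex \<Rightarrow> C01 \<Rightarrow> C01"
  where "R\<^sub>T \<equiv> resolvent F_space deriv01"

definition K :: "complex \<Rightarrow> C01 \<Rightarrow> real \<Rightarrow> complex"
  where "K \<zeta> f x = exp (\<zeta> * of_real x) * integral {0..x} (\<lambda>t. exp (- \<zeta> * of_real t) * ev f t)"

end

theory Submission
  imports Defs "HOL-Real_Asymp.Real_Asymp"
begin

text \<open>The equation \<open>\<zeta>u - u' = f\<close> has the solutions \<open>u(x) = e\<^bsup>\<zeta>x\<^esup>c - K\<^sub>\<zeta>f(x)\<close>, and the condition
  \<open>u(0) = u(1/2)\<close> reads \<open>(e\<^bsup>\<zeta>/2\<^esup> - 1)c = K\<^sub>\<zeta>f(1/2)\<close>. So \<open>\<zeta>\<close> is in the resolvent set if and only if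
  \<open>e\<^bsup>\<zeta>/2\<^esup> \<noteq> 1\<close>; otherwise \<open>x \<mapsto> e\<^bsup>\<zeta>x\<^esup>\<close> is an eigenfunction. The operator is closed because its
  resolvent at \<open>1\<close> is bounded. The resolvent is large because the condition at \<open>0\<close> and \<open>1/2\<close> does
  not see \<open>(1/2,1]\<close>: for \<open>f(x) = e\<^bsup>\<zeta>/2\<^esup> max(0, 2x - 1)\<close> the constant \<open>c\<close> vanishes.\<close>

section \<open>Resolvents of operators on a complex Banach space\<close>

lemma module_scaleC: "module (scaleC :: complex \<Rightarrow> 'a \<Rightarrow> 'a::complex_normed_vector)"
  using vector_space_scaleC by (simp add: vector_space_def module_def)

lemmas csubspace_def = module.subspace_def[OF module_scaleC]

lemma scaleC_minus_one: "(- 1) *\<^sub>C x = - (x :: 'a::complex_normed_vector)"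
  using scaleC_of_real[of "-1" x] by simp

lemma csubspace_diff:
  assumes "csubspace V" "x \<in> V" "y \<in> V"
  shows "x - y \<in> V"
  using assms scaleC_minus_one[of y] unfolding csubspace_def
  by (metis diff_conv_add_uminus)

lemma clinear_on_diff:
  assumes V: "csubspace V" and L: "clinear_on V L" "x \<in> V" "y \<in> V"
  shows "L (x - y) = L x - L y"
proof -
  have "(-1) *\<^sub>C y \<in> V"
    using V L(3) unfolding csubspace_def by blast
  then have "L (x + (-1) *\<^sub>C y) = L x + (-1) *\<^sub>C L y"
    using L unfolding clinear_on_def by simp
  then show ?thesis
    by (simp add: scaleC_minus_one)
qed

lemma scaleC_diff_right: "a *\<^sub>C (x - y) = a *\<^sub>C x - a *\<^sub>C (y :: 'a::complex_normed_vector)"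
  by (rule clinear_on_diff[where V = UNIV])
    (simp_all add: csubspace_def clinear_on_def scaleC_add_right scaleC_scaleC mult.commute)

lemma clinear_on_scaleC_minus:
  assumes "clinear_on F T"
  shows "clinear_on F (\<lambda>u. \<zeta> *\<^sub>C u - T u)"
  using assms unfolding clinear_on_def
  by (simp add: scaleC_add_right scaleC_scaleC scaleC_diff_right mult.commute)

text \<open>\<open>resolvent_set\<close> asks for linearity of the inverse as a separate condition;
  it follows from linearity of the map, since both sides of each identity lie in \<open>F\<close>
  and have the same image under the injective \<open>L\<close>.\<close>

lemma clinear_on_inv_into:
  assumes bij: "bij_betw L F E" and F: "csubspace F" and L: "clinear_on F L"
  shows "clinear_on E (inv_into F L)"
proof -
  have inF: "inv_into F L f \<in> F" and LR: "L (inv_into F L f) = f" if "f \<in> E" for f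
    using bij that by (auto simp: bij_betw_def f_inv_into_f inv_into_into)
  have inv: "inv_into F L y = u" if "u \<in> F" "L u = y" for u y
    using bij that by (auto simp: bij_betw_def)
  show ?thesis
    unfolding clinear_on_def
  proof (intro conjI ballI allI)
    fix f g assume "f \<in> E" "g \<in> E"
    then show "inv_into F L (f + g) = inv_into F L f + inv_into F L g"
      using F L inF LR by (intro inv) (auto simp: csubspace_def clinear_on_def)
  next
    fix c f assume "f \<in> E"
    then show "inv_into F L (c *\<^sub>C f) = c *\<^sub>C inv_into F L f"
      using F L inF LR by (intro inv) (auto simp: csubspace_def clinear_on_def)
  qed
qed

section \<open>Resolvent points, boundedness of the resolvent, and closedness\<close>

lemma resolvent_of_bij_betw:
  assumes bij: "bij_betw (\<lambda>u. \<zeta> *\<^sub>C u - T u) F E" and f: "f \<in> E"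
  shows "resolvent F T \<zeta> f \<in> F"
    and "\<zeta> *\<^sub>C resolvent F T \<zeta> f - T (resolvent F T \<zeta> f) = f"
  using bij_betw_inv_into_right[OF bij f] bij_betw_apply[OF bij_betw_inv_into[OF bij] f]
  unfolding resolvent_def by blast+

text \<open>An ambient-norm bound gives a graph-norm bound: \<open>T\<close> applied to the
  resolvent of \<open>f\<close> is \<open>\<zeta>\<close> times that resolvent minus
  \<open>f\<close>, so its norm is at most \<open>(cmod \<zeta> * C + 1) * norm f\<close>.\<close>

lemma resolvent_setI:
  assumes bij: "bij_betw (\<lambda>u. \<zeta> *\<^sub>C u - T u) F E"
    and F: "csubspace F" and T: "clinear_on F T"
    and bound: "\<And>f. f \<in> E \<Longrightarrow> norm (resolvent F T \<zeta> f) \<le> C * norm f"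
  shows "\<zeta> \<in> resolvent_set E F T"
proof -
  have "graph_norm T (resolvent F T \<zeta> f) \<le> (C + (cmod \<zeta> * C + 1)) * norm f" if f: "f \<in> E" for f
  proof -
    let ?u = "resolvent F T \<zeta> f"
    have "\<zeta> *\<^sub>C ?u - T ?u = f"
      using bij f by (rule resolvent_of_bij_betw)
    then have "T ?u = \<zeta> *\<^sub>C ?u - f"
      by (simp add: algebra_simps)
    then have "norm (T ?u) \<le> cmod \<zeta> * norm ?u + norm f"
      using norm_triangle_ineq4[of "\<zeta> *\<^sub>C ?u" f] by (simp add: norm_scaleC)
    moreover have "cmod \<zeta> * norm ?u \<le> cmod \<zeta> * (C * norm f)"
      using bound[OF f] by (intro mult_left_mono) auto
    ultimately show ?thesis
      using bound[OF f] by (simp add: graph_norm_def algebra_simps)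
  qed
  moreover have "clinear_on E (resolvent F T \<zeta>)"
    unfolding resolvent_def using bij F clinear_on_scaleC_minus[OF T] by (rule clinear_on_inv_into)
  ultimately show ?thesis
    using bij unfolding resolvent_set_def by blast
qed

lemma resolvent_unique:
  assumes "\<zeta> \<in> resolvent_set E F T" "u \<in> F" "\<zeta> *\<^sub>C u - T u = f"
  shows "resolvent F T \<zeta> f = u"
  using bij_betw_inv_into_left[of "\<lambda>u. \<zeta> *\<^sub>C u - T u" F E u] assms
  unfolding resolvent_set_def resolvent_def by simp

lemma resolvent_in:
  assumes "\<zeta> \<in> resolvent_set E F T" "f \<in> E"
  shows "resolvent F T \<zeta> f \<in> F"
    and "\<zeta> *\<^sub>C resolvent F T \<zeta> f - T (resolvent F T \<zeta> f) = f"
  using assms by (auto simp: resolvent_set_def intro: resolvent_of_bij_betw)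

lemma resolvent_bounded:
  assumes "\<zeta> \<in> resolvent_set E F T"
  obtains C where "\<And>f. f \<in> E \<Longrightarrow> norm (resolvent F T \<zeta> f) \<le> C * norm f"
proof -
  obtain C where C: "\<forall>f\<in>E. graph_norm T (resolvent F T \<zeta> f) \<le> C * norm f"
    using assms unfolding resolvent_set_def by auto
  have "norm (resolvent F T \<zeta> f) \<le> C * norm f" if "f \<in> E" for f
  proof -
    have "norm (resolvent F T \<zeta> f) \<le> graph_norm T (resolvent F T \<zeta> f)"
      by (simp add: graph_norm_def)
    then show ?thesis using C that by force
  qed
  then show ?thesis by (rule that)
qed

text \<open>One resolvent point suffices. If \<open>w n\<close> tends to \<open>u\<close> and
  \<open>T (w n)\<close> to \<open>v\<close>, then \<open>h n\<close> tends to \<open>g\<close>, and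
  boundedness of the resolvent makes \<open>w n\<close>, which is the resolvent of
  \<open>h n\<close>, tend to the resolvent of \<open>g\<close>. Hence \<open>u\<close> is the
  resolvent of \<open>g\<close>; so it lies in \<open>F\<close>, and the resolvent equation at
  \<open>g\<close> reads \<open>T u = v\<close>.\<close>

lemma closed_operatorI_resolvent:
  assumes E: "csubspace E" "closed E" and F: "csubspace F" "F \<subseteq> E"
    and T: "clinear_on F T" "T ` F \<subseteq> E" and \<zeta>: "\<zeta> \<in> resolvent_set E F T"
  shows "closed_operator E F T"
proof -
  let ?R = "resolvent F T \<zeta>"
  obtain C where C: "\<And>f. f \<in> E \<Longrightarrow> norm (?R f) \<le> C * norm f"
    using resolvent_bounded[OF \<zeta>] by blast
  have R: "clinear_on E ?R"
    using \<zeta> by (simp add: resolvent_set_def)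
  have "u \<in> F \<and> v = T u"
    if w: "\<forall>n::nat. w n \<in> F" and u: "u \<in> E" "w \<longlonglongrightarrow> u" and v: "v \<in> E" "(\<lambda>n. T (w n)) \<longlonglongrightarrow> v"
    for w u v
  proof -
    define g where "g = \<zeta> *\<^sub>C u - v"
    define h where "h n = \<zeta> *\<^sub>C w n - T (w n)" for n
    have gE: "g \<in> E"
      unfolding g_def using E u v by (intro csubspace_diff) (auto simp: csubspace_def)
    have hE: "h n \<in> E" for n
      unfolding h_def using E F T w by (intro csubspace_diff) (auto simp: csubspace_def)
    have Rh: "?R (h n) = w n" for n
      using resolvent_unique[OF \<zeta>] w by (simp add: h_def)
    have lim: "(\<lambda>n. cmod \<zeta> * norm (w n - u) + norm (T (w n) - v)) \<longlonglongrightarrow> 0"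
      using tendsto_add[OF tendsto_mult_left[OF tendsto_norm_zero[OF LIM_zero[OF u(2)]]]
          tendsto_norm_zero[OF LIM_zero[OF v(2)]], of "cmod \<zeta>"] by simp
    have "(\<lambda>n. h n - g) \<longlonglongrightarrow> 0"
    proof (rule Lim_null_comparison[OF always_eventually lim], rule allI)
      fix n
      have "h n - g = \<zeta> *\<^sub>C (w n - u) - (T (w n) - v)"
        by (simp add: h_def g_def scaleC_diff_right)
      then show "norm (h n - g) \<le> cmod \<zeta> * norm (w n - u) + norm (T (w n) - v)"
        using norm_triangle_ineq4 by (metis norm_scaleC)
    qed
    then have lim': "(\<lambda>n. C * norm (h n - g)) \<longlonglongrightarrow> 0"
      using tendsto_mult_left[OF tendsto_norm_zero, of _ _ C] by simp
    have "(\<lambda>n. w n - ?R g) \<longlonglongrightarrow> 0"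
    proof (rule Lim_null_comparison[OF always_eventually lim'], rule allI)
      fix n
      have "w n - ?R g = ?R (h n - g)"
        using clinear_on_diff[OF E(1) R hE gE] Rh by simp
      then show "norm (w n - ?R g) \<le> C * norm (h n - g)"
        using C[OF csubspace_diff[OF E(1) hE gE]] by simp
    qed
    then have "w \<longlonglongrightarrow> ?R g"
      by (rule LIM_zero_cancel)
    then have "?R g = u"
      using u(2) LIMSEQ_unique by blast
    then show ?thesis
      using resolvent_in[OF \<zeta> gE] by (auto simp: g_def)
  qed
  with assms show ?thesis
    unfolding closed_operator_def by blast
qed

text \<open>A supremum of reals dominates its terms only when they are bounded above, which is what
  the bound by \<open>C\<close> provides.\<close>

lemma onorm_on_ge:
  assumes C: "\<And>g. g \<in> E \<Longrightarrow> norm (S g) \<le> C * norm g" and f: "f \<in> E"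
  shows "norm (S f) / norm f \<le> onorm_on E S"
  unfolding onorm_on_def
proof (rule cSUP_upper[OF f])
  show "bdd_above ((\<lambda>f. norm (S f) / norm f) ` E)"
  proof (rule bdd_aboveI2)
    fix g assume "g \<in> E"
    \<comment> \<open>The absolute value covers a negative \<open>C\<close>: that is possible when
      \<open>E\<close> contains only 0, where the quotient is 0 by the convention on
      division.\<close>
    then show "norm (S g) / norm g \<le> \<bar>C\<bar>"
      using C[of g] abs_ge_self[of C]
      by (cases "g = 0") (auto simp: divide_simps intro: order_trans mult_right_mono)
  qed
qed

section \<open>Functions on the unit interval\<close>

lemma C01_eqI:
  assumes "\<And>x. x \<in> {0..1} \<Longrightarrow> ev f x = ev g x"
  shows "f = g"
  using ex1_ev_eq[OF continuous_on_ev[of f]] assms by metis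

lemma ev_simps [simp]:
  "ev (f + g) x = ev f x + ev g x"
  "ev (f - g) x = ev f x - ev g x"
  "ev (c *\<^sub>C f) x = c * ev f x"
  "ev 0 x = 0"
  by (simp_all add: ev_def apply_scaleC_bcontfun scaleC_complex_def)

lemma cmod_ev_le: "cmod (ev f x) \<le> norm f"
  unfolding ev_def by (rule norm_bounded)

lemma norm_C01_le:
  fixes f :: C01
  assumes "\<And>x. x \<in> {0..1} \<Longrightarrow> cmod (ev f x) \<le> B"
  shows "norm f \<le> B"
proof (rule norm_bound)
  fix t
  show "cmod (apply_bcontfun f t) \<le> B"
    using assms[OF Rep_unit_interval[of t]] by (simp add: ev_def Rep_unit_interval_inverse)
qed

lemma has_deriv01_add:
  assumes "has_deriv01 u v" "has_deriv01 u' v'"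
  shows "has_deriv01 (u + u') (v + v')"
proof -
  have "ev (u + u') = (\<lambda>x. ev u x + ev u' x)" by auto
  with assms show ?thesis
    unfolding has_deriv01_def by (auto intro!: has_vector_derivative_add)
qed

lemma has_deriv01_scaleC:
  assumes "has_deriv01 u v"
  shows "has_deriv01 (c *\<^sub>C u) (c *\<^sub>C v)"
proof -
  have "ev (c *\<^sub>C u) = (\<lambda>x. c * ev u x)" by auto
  with assms show ?thesis
    unfolding has_deriv01_def by (auto intro!: has_vector_derivative_mult_right)
qed

section \<open>The operator\<close>

lemma E_space_iff: "f \<in> E_space \<longleftrightarrow> ev f 0 = ev f (1/2)"
  by (auto simp: E_space_def Lam_def)

text \<open>Replaces the definite description in \<open>deriv01\<close> by a witness, so that
  membership can be proved by exhibiting the derivative.\<close>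

lemma F_space_iff: "u \<in> F_space \<longleftrightarrow> u \<in> E_space \<and> (\<exists>v\<in>E_space. has_deriv01 u v)"
  unfolding F_space_def D_space_def using deriv01_eqI by auto

lemma csubspace_E_space: "csubspace E_space"
  by (auto simp: csubspace_def E_space_iff)

lemma closed_E_space: "closed E_space"
proof -
  have "E_space = (\<lambda>f. ev f 0 - ev f (1/2)) -` {0}"
    by (auto simp: E_space_iff)
  \<comment> \<open>Evaluation at \<open>x\<close> is linear and bounded by the sup norm, hence
    1-Lipschitz.\<close>
  moreover have "continuous_on UNIV (\<lambda>f. ev f x)" for x
    unfolding continuous_on_iff
    by (metis cmod_ev_le dist_norm ev_simps(2) order_le_less_trans)
  then have "closed ((\<lambda>f. ev f 0 - ev f (1/2)) -` {0})"
    by (intro continuous_closed_vimage continuous_at_imp_continuous_on closed_singleton)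
      (auto simp: continuous_on_eq_continuous_at intro!: continuous_diff)
  ultimately show ?thesis by simp
qed

lemma has_deriv01_zero: "has_deriv01 0 0"
proof -
  have "ev 0 = (\<lambda>x. 0)" by auto
  then show ?thesis
    by (simp add: has_deriv01_def)
qed

lemma csubspace_F_space: "csubspace F_space"
  unfolding csubspace_def
proof (intro conjI ballI allI)
  show "0 \<in> F_space"
    using has_deriv01_zero csubspace_E_space unfolding csubspace_def F_space_iff by blast
next
  fix u v assume "u \<in> F_space" "v \<in> F_space"
  then obtain u' v' where "u \<in> E_space" "u' \<in> E_space" "has_deriv01 u u'"
    and "v \<in> E_space" "v' \<in> E_space" "has_deriv01 v v'"
    unfolding F_space_iff by blast
  then show "u + v \<in> F_space"
    using has_deriv01_add[of u u' v v'] csubspace_E_space unfolding csubspace_def F_space_iff by blast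
next
  fix c u assume "u \<in> F_space"
  then obtain u' where "u \<in> E_space" "u' \<in> E_space" "has_deriv01 u u'"
    unfolding F_space_iff by blast
  then show "c *\<^sub>C u \<in> F_space"
    using has_deriv01_scaleC[of u u' c] csubspace_E_space unfolding csubspace_def F_space_iff by blast
qed

lemma F_space_deriv01:
  assumes "u \<in> F_space"
  shows "has_deriv01 u (deriv01 u)" "deriv01 u \<in> E_space" "u \<in> E_space"
  using assms deriv01_eqI unfolding F_space_iff by auto

lemma clinear_on_deriv01: "clinear_on F_space deriv01"
  by (simp add: clinear_on_def deriv01_eqI has_deriv01_add has_deriv01_scaleC F_space_deriv01(1))

section \<open>Solving the resolvent equation by variation of constants\<close>

lemma exp_integrand_continuous: "continuous_on {0..1} (\<lambda>t. exp (- \<zeta> * of_real t) * ev f t)"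
  by (intro continuous_intros continuous_on_ev)

lemma has_vector_derivative_exp:
  fixes \<zeta> :: complex
  shows "((\<lambda>x. exp (\<zeta> * of_real x)) has_vector_derivative \<zeta> * exp (\<zeta> * of_real x)) (at x within S)"
proof -
  have "((\<lambda>z. exp (\<zeta> * z)) has_field_derivative \<zeta> * exp (\<zeta> * of_real x)) (at (of_real x))"
    by (auto intro!: derivative_eq_intros)
  then show ?thesis
    by (rule has_vector_derivative_real_field)
qed

text \<open>Product rule: differentiating the exponential factor gives
  \<open>\<zeta> * K \<zeta> f x\<close>, and differentiating the integral gives
  \<open>ev f x\<close> after the two exponentials cancel. So \<open>- K \<zeta> f\<close> is a
  particular solution of the resolvent equation with value 0 at 0.\<close>

lemma K_has_vector_derivative:
  assumes "x \<in> {0..1}"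
  shows "(K \<zeta> f has_vector_derivative \<zeta> * K \<zeta> f x + ev f x) (at x within {0..1})"
proof -
  have "((\<lambda>x. integral {0..x} (\<lambda>t. exp (- \<zeta> * of_real t) * ev f t))
      has_vector_derivative exp (- \<zeta> * of_real x) * ev f x) (at x within {0..1})"
    using exp_integrand_continuous assms by (rule integral_has_vector_derivative)
  from has_vector_derivative_mult[OF has_vector_derivative_exp[of \<zeta>] this]
  have "((\<lambda>x. K \<zeta> f x) has_vector_derivative
      exp (\<zeta> * of_real x) * (exp (- \<zeta> * of_real x) * ev f x) + \<zeta> * K \<zeta> f x) (at x within {0..1})"
    by (simp add: K_def mult.assoc)
  then show ?thesis
    by (simp add: mult.assoc[symmetric] exp_add[symmetric] add.commute)
qed

text \<open>Integrating factor: the derivative of \<open>?h\<close> is minus the integrand of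
  \<open>K\<close>, so integrating over \<open>{0..x}\<close> recovers \<open>u\<close> from
  \<open>ev u 0\<close> and \<open>f\<close>. No boundary condition enters yet.\<close>

lemma variation_of_constants:
  assumes u: "has_deriv01 u v" and f: "\<zeta> *\<^sub>C u - v = f" and x: "x \<in> {0..1}"
  shows "ev u x = exp (\<zeta> * of_real x) * ev u 0 - K \<zeta> f x"
proof -
  let ?h = "\<lambda>x. exp (- \<zeta> * of_real x) * ev u x"
  have "(?h has_vector_derivative - (exp (- \<zeta> * of_real t) * ev f t)) (at t within {0..x})"
    if t: "t \<in> {0..x}" for t
  proof -
    have "(ev u has_vector_derivative ev v t) (at t within {0..x})"
      by (rule has_vector_derivative_within_subset[of _ _ _ "{0..1}"])
        (use u x t in \<open>auto simp: has_deriv01_def\<close>)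
    from has_vector_derivative_mult[OF has_vector_derivative_exp[of "-\<zeta>"] this]
    show ?thesis
      by (simp add: f[symmetric] algebra_simps)
  qed
  from fundamental_theorem_of_calculus[OF _ this]
  have "((\<lambda>t. - (exp (- \<zeta> * of_real t) * ev f t)) has_integral ?h x - ?h 0) {0..x}"
    using x by simp
  from has_integral_neg[OF this]
  have "integral {0..x} (\<lambda>t. exp (- \<zeta> * of_real t) * ev f t) = ?h 0 - ?h x"
    by (simp add: integral_unique)
  then have "K \<zeta> f x = exp (\<zeta> * of_real x) * (ev u 0 - ?h x)"
    by (simp add: K_def)
  then show ?thesis
    by (simp add: right_diff_distrib mult.assoc[symmetric] exp_add[symmetric])
qed

text \<open>Evaluating the general solution at 1/2 and using \<open>ev u 0 = ev u (1/2)\<close>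
  determines the free constant \<open>ev u 0\<close>. As the result depends on \<open>f\<close>
  alone, it yields both injectivity and the resolvent formula.\<close>

lemma F_space_solution:
  assumes u: "u \<in> F_space" and f: "\<zeta> *\<^sub>C u - deriv01 u = f"
    and \<zeta>: "exp (\<zeta> / 2) \<noteq> 1" and x: "x \<in> {0..1}"
  shows "ev u x = exp (\<zeta> * of_real x) / (exp (\<zeta> / 2) - 1) * K \<zeta> f (1/2) - K \<zeta> f x"
proof -
  note sol = variation_of_constants[OF F_space_deriv01(1)[OF u] f]
  have "ev u 0 = exp (\<zeta> / 2) * ev u 0 - K \<zeta> f (1/2)"
    using sol[of "1/2"] F_space_deriv01(3)[OF u] by (simp add: E_space_iff)
  then have "ev u 0 * (exp (\<zeta> / 2) - 1) = K \<zeta> f (1/2)"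
    by (simp add: algebra_simps)
  then have "ev u 0 = K \<zeta> f (1/2) / (exp (\<zeta> / 2) - 1)"
    using \<zeta> by (simp add: nonzero_eq_divide_eq)
  then show ?thesis
    using sol[OF x] by simp
qed

lemma F_space_solution_exists:
  assumes f: "f \<in> E_space" and \<zeta>: "exp (\<zeta> / 2) \<noteq> 1"
  obtains u where "u \<in> F_space" "\<zeta> *\<^sub>C u - deriv01 u = f"
proof -
  \<comment> \<open>The value of \<open>c\<close> for which \<open>g\<close> takes the same value at
    0 and at 1/2.\<close>
  define c where "c = K \<zeta> f (1/2) / (exp (\<zeta> / 2) - 1)"
  define g where "g x = exp (\<zeta> * of_real x) * c - K \<zeta> f x" for x :: real
  have g: "(g has_vector_derivative \<zeta> * g x - ev f x) (at x within {0..1})" if "x \<in> {0..1}" for x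
  proof -
    have "((\<lambda>x. exp (\<zeta> * of_real x) * c - K \<zeta> f x) has_vector_derivative
        \<zeta> * exp (\<zeta> * of_real x) * c - (\<zeta> * K \<zeta> f x + ev f x)) (at x within {0..1})"
      using that by (intro has_vector_derivative_diff has_vector_derivative_mult_left
          has_vector_derivative_exp K_has_vector_derivative)
    then show ?thesis
      by (simp add: g_def[abs_def] algebra_simps)
  qed
  have "continuous_on {0..1} g"
    unfolding continuous_on_eq_continuous_within
    using g has_vector_derivative_continuous by blast
  from ex1_implies_ex[OF ex1_ev_eq[OF this]]
  obtain u :: C01 where u: "\<And>x. x \<in> {0..1} \<Longrightarrow> ev u x = g x"
    by blast
  have deriv: "has_deriv01 u (\<zeta> *\<^sub>C u - f)"
    unfolding has_deriv01_def
  proof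
    fix x :: real assume x: "x \<in> {0..1}"
    show "(ev u has_vector_derivative ev (\<zeta> *\<^sub>C u - f) x) (at x within {0..1})"
      by (rule has_vector_derivative_transform[OF x u]) (use g[OF x] u[OF x] in auto)
  qed
  have "exp (\<zeta> / 2) * c - K \<zeta> f (1/2) = c"
    using \<zeta> by (simp add: c_def field_simps)
  moreover have "ev u (1/2) = exp (\<zeta> / 2) * c - K \<zeta> f (1/2)"
    using u[of "1/2"] by (simp add: g_def)
  moreover have "ev u 0 = c"
    using u[of 0] by (simp add: g_def K_def)
  ultimately have uE: "u \<in> E_space"
    unfolding E_space_iff by simp
  \<comment> \<open>This element is the derivative of \<open>u\<close>; it inherits the condition at
    0 and 1/2 from \<open>u\<close> and \<open>f\<close>.\<close>
  moreover have "\<zeta> *\<^sub>C u - f \<in> E_space"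
    using uE f by (simp add: E_space_iff)
  ultimately have "u \<in> F_space"
    using deriv unfolding F_space_iff by blast
  then show ?thesis
    using that[of u] deriv01_eqI[OF deriv] by simp
qed

section \<open>The resolvent set, the spectrum and the resolvent formula\<close>

lemma cmod_exp_le:
  assumes "\<bar>x\<bar> \<le> 1"
  shows "cmod (exp (\<zeta> * of_real x)) \<le> exp (cmod \<zeta>)"
proof -
  have "cmod \<zeta> * \<bar>x\<bar> \<le> cmod \<zeta> * 1"
    using assms by (intro mult_left_mono) auto
  then show ?thesis
    using order_trans[OF norm_exp, of "\<zeta> * of_real x" "exp (cmod \<zeta>)"] by (simp add: norm_mult)
qed

text \<open>One factor \<open>exp (cmod \<zeta>)\<close> bounds the exponential in front, the other
  the exponential in the integrand; the interval of integration has length at most 1.\<close>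

lemma cmod_K_le:
  assumes x: "x \<in> {0..1}"
  shows "cmod (K \<zeta> f x) \<le> exp (cmod \<zeta>) * exp (cmod \<zeta>) * norm f"
proof -
  let ?g = "\<lambda>t. exp (- \<zeta> * of_real t) * ev f t"
  have "cmod (integral {0..x} ?g) \<le> exp (cmod \<zeta>) * norm f * (x - 0)"
  proof (rule integral_bound)
    show "continuous_on {0..x} ?g"
      using x by (intro continuous_on_subset[OF exp_integrand_continuous]) auto
    fix t assume "t \<in> {0..x}"
    then show "cmod (?g t) \<le> exp (cmod \<zeta>) * norm f"
      using x cmod_exp_le[of t "-\<zeta>"] cmod_ev_le[of f t]
      by (simp add: norm_mult mult_mono)
  qed (use x in auto)
  also have "\<dots> \<le> exp (cmod \<zeta>) * norm f"
    using x by (simp add: mult_left_le)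
  finally show ?thesis
    using x cmod_exp_le[of x \<zeta>] by (simp add: K_def norm_mult mult.assoc mult_mono)
qed

lemma in_resolvent_setI:
  assumes \<zeta>: "exp (\<zeta> / 2) \<noteq> 1"
  shows "\<zeta> \<in> \<rho>\<^sub>T"
proof -
  let ?L = "\<lambda>u. \<zeta> *\<^sub>C u - deriv01 u"
  have "inj_on ?L F_space"
    by (intro inj_onI C01_eqI) (simp add: F_space_solution[OF _ _ \<zeta>])
  moreover have "?L ` F_space = E_space"
    using F_space_deriv01 F_space_solution_exists[OF _ \<zeta>] by (force simp: E_space_iff)
  ultimately have bij: "bij_betw ?L F_space E_space"
    by (simp add: bij_betw_def)
  define B where "B = exp (cmod \<zeta>) * exp (cmod \<zeta>)"
  \<comment> \<open>The two summands bound the two terms of \<open>F_space_solution\<close>, with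
    \<open>B * norm f\<close> bounding \<open>K\<close>.\<close>
  define C where "C = exp (cmod \<zeta>) / cmod (exp (\<zeta> / 2) - 1) * B + B"
  show ?thesis
  proof (rule resolvent_setI[OF bij csubspace_F_space clinear_on_deriv01, of C])
    fix f assume f: "f \<in> E_space"
    let ?u = "R\<^sub>T \<zeta> f"
    have u: "?u \<in> F_space" "?L ?u = f"
      using bij f by (rule resolvent_of_bij_betw)+
    show "norm ?u \<le> C * norm f"
    proof (rule norm_C01_le)
      fix x :: real assume x: "x \<in> {0..1}"
      have "cmod (ev ?u x) \<le> cmod (exp (\<zeta> * of_real x) / (exp (\<zeta> / 2) - 1)) * cmod (K \<zeta> f (1/2))
          + cmod (K \<zeta> f x)"
        unfolding F_space_solution[OF u \<zeta> x] norm_mult[symmetric] by (rule norm_triangle_ineq4)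
      also have "\<dots> \<le> exp (cmod \<zeta>) / cmod (exp (\<zeta> / 2) - 1) * (B * norm f) + B * norm f"
        unfolding norm_divide B_def
        by (intro add_mono mult_mono divide_right_mono cmod_exp_le cmod_K_le) (use x in auto)
      finally show "cmod (ev ?u x) \<le> C * norm f"
        by (simp add: C_def algebra_simps)
    qed
  qed
qed

text \<open>The exponential \<open>u\<close> satisfies the boundary condition exactly because
  \<open>exp (\<zeta> / 2) = 1\<close>, and so does its derivative, a multiple of \<open>u\<close>.
  Then \<open>u\<close> and 0 are two elements of \<open>F_space\<close> with image 0, against
  injectivity.\<close>

lemma not_in_resolvent_setI:
  assumes \<zeta>: "exp (\<zeta> / 2) = 1"
  shows "\<zeta> \<notin> \<rho>\<^sub>T"
proof
  assume \<rho>: "\<zeta> \<in> \<rho>\<^sub>T"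
  have "continuous_on {0..1} (\<lambda>x. exp (\<zeta> * complex_of_real x))"
    by (intro continuous_intros)
  from ex1_implies_ex[OF ex1_ev_eq[OF this]]
  obtain u :: C01 where u: "\<And>x. x \<in> {0..1} \<Longrightarrow> ev u x = exp (\<zeta> * of_real x)"
    by blast
  have deriv: "has_deriv01 u (\<zeta> *\<^sub>C u)"
    unfolding has_deriv01_def
  proof
    fix x :: real assume x: "x \<in> {0..1}"
    show "(ev u has_vector_derivative ev (\<zeta> *\<^sub>C u) x) (at x within {0..1})"
      by (rule has_vector_derivative_transform[OF x u])
        (use has_vector_derivative_exp[of \<zeta>] u[OF x] in auto)
  qed
  have uE: "u \<in> E_space"
    using u[of 0] u[of "1/2"] \<zeta> by (simp add: E_space_iff)
  then have "\<zeta> *\<^sub>C u \<in> E_space"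
    by (simp add: E_space_iff)
  with uE deriv have "u \<in> F_space"
    unfolding F_space_iff by blast
  moreover have "\<zeta> *\<^sub>C u - deriv01 u = 0"
    using deriv01_eqI[OF deriv] by simp
  moreover have "\<zeta> *\<^sub>C 0 - deriv01 0 = 0"
    using deriv01_eqI[OF has_deriv01_zero] by (auto intro: C01_eqI)
  moreover have "0 \<in> F_space"
    using csubspace_F_space by (simp add: csubspace_def)
  ultimately have "u = 0"
    using resolvent_unique[OF \<rho>] by metis
  then show False
    using u[of 0] by simp
qed

lemma resolvent_set_iff: "\<zeta> \<in> \<rho>\<^sub>T \<longleftrightarrow> exp (\<zeta> / 2) \<noteq> 1"
  using in_resolvent_setI not_in_resolvent_setI by blast

text \<open>The solutions of \<open>exp z = 1\<close> are the integer multiples of 2 pi i; with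
  \<open>z = \<zeta> / 2\<close> the spacing doubles.\<close>

lemma spectrum_eq: "\<sigma>\<^sub>T = {4 * \<i> * of_real pi * of_int n | n :: int. True}"
proof -
  have "exp (\<zeta> / 2) = 1 \<longleftrightarrow> (\<exists>n::int. \<zeta> = 4 * \<i> * of_real pi * of_int n)" for \<zeta> :: complex
    unfolding exp_eq_1 by (auto simp: complex_eq_iff)
  then show ?thesis
    unfolding spectrum_def Compl_eq resolvent_set_iff by auto
qed

lemma closed_operator_deriv01: "closed_operator E_space F_space deriv01"
proof (rule closed_operatorI_resolvent)
  have "exp (1 / 2) \<noteq> (1 :: real)"
    by simp
  then have "exp (1 / 2) \<noteq> (1 :: complex)"
    using exp_of_real[of "1/2", where 'a = complex]
    by (metis of_real_1 of_real_divide of_real_eq_iff of_real_numeral)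
  then show "1 \<in> \<rho>\<^sub>T"
    by (rule in_resolvent_setI)
qed (use F_space_deriv01 in \<open>auto intro: csubspace_E_space closed_E_space csubspace_F_space clinear_on_deriv01\<close>)

lemma resolvent_formula:
  assumes f: "f \<in> E_space" and \<zeta>: "\<zeta> \<in> \<rho>\<^sub>T" and x: "x \<in> {0..1}"
  shows "ev (R\<^sub>T \<zeta> f) x = exp (\<zeta> * of_real x) / (exp (\<zeta> / 2) - 1) * K \<zeta> f (1/2) - K \<zeta> f x"
  using F_space_solution[OF resolvent_in[OF \<zeta> f] _ x] \<zeta> by (simp add: resolvent_set_iff)

lemma pos_in_resolvent_set:
  fixes \<zeta> :: real
  assumes "\<zeta> > 0"
  shows "complex_of_real \<zeta> \<in> \<rho>\<^sub>T"
proof (rule in_resolvent_setI)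
  have "complex_of_real (exp (\<zeta> / 2)) \<noteq> 1"
    using assms by simp
  then show "exp (complex_of_real \<zeta> / 2) \<noteq> 1"
    by (simp add: exp_of_real[symmetric])
qed

section \<open>Growth of the resolvent\<close>

text \<open>The ramp vanishes on \<open>{0..1/2}\<close>, which gives membership in
  \<open>E_space\<close> and \<open>K = 0\<close> at 1/2. It rises linearly to
  \<open>exp (\<zeta> / 2)\<close> at 1, where the norm is attained, and only
  \<open>{1/2..1}\<close> contributes to \<open>K\<close> at 1.\<close>

lemma ramp_exists:
  fixes \<zeta> :: real
  assumes \<zeta>: "\<zeta> > 0"
  obtains f where "f \<in> E_space" "ev f 0 = 0" "ev f (1/2) = 0" "norm f = exp (\<zeta> / 2)"
    "K (of_real \<zeta>) f (1/2) = 0"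
    "K (of_real \<zeta>) f 1 = of_real (2 * exp \<zeta> / \<zeta>\<^sup>2 - exp (\<zeta> / 2) * (1 / \<zeta> + 2 / \<zeta>\<^sup>2))"
proof -
  have "continuous_on {0..1} (\<lambda>x. complex_of_real (exp (\<zeta> / 2) * max 0 (2 * x - 1)))"
    by (intro continuous_intros)
  from ex1_implies_ex[OF ex1_ev_eq[OF this]]
  obtain f :: C01
    where f: "\<And>x. x \<in> {0..1} \<Longrightarrow> ev f x = of_real (exp (\<zeta> / 2) * max 0 (2 * x - 1))"
    by blast
  let ?g = "\<lambda>t. exp (- complex_of_real \<zeta> * of_real t) * ev f t"
  have left: "(?g has_integral 0) {0..1/2}"
    by (rule has_integral_is_0) (simp add: f)
  \<comment> \<open>Antiderivative, found by parts, of the integrand on the right half, where the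
    maximum equals \<open>2 * t - 1\<close>.\<close>
  define G where "G t = - (exp (\<zeta> / 2) * exp (- \<zeta> * t) * ((2 * t - 1) / \<zeta> + 2 / \<zeta>\<^sup>2))" for t
  have "((\<lambda>t. exp (- \<zeta> * t) * (exp (\<zeta> / 2) * (2 * t - 1))) has_integral G 1 - G (1/2)) {1/2..1}"
  proof (rule fundamental_theorem_of_calculus)
    fix t :: real
    have "(G has_field_derivative exp (- \<zeta> * t) * (exp (\<zeta> / 2) * (2 * t - 1))) (at t)"
      unfolding G_def[abs_def] using \<zeta>
      by (auto intro!: derivative_eq_intros simp: field_simps power2_eq_square)
    then show "(G has_vector_derivative exp (- \<zeta> * t) * (exp (\<zeta> / 2) * (2 * t - 1)))
        (at t within {1/2..1})"
      by (simp add: has_real_derivative_iff_has_vector_derivative has_vector_derivative_at_within)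
  qed simp
  from has_integral_linear[OF this bounded_linear_of_real[where 'a = complex]]
  have right: "(?g has_integral of_real (G 1 - G (1/2))) {1/2..1}"
    by (rule has_integral_eq[rotated]) (simp add: f exp_of_real[symmetric])
  have whole: "(?g has_integral of_real (G 1 - G (1/2))) {0..1}"
    using has_integral_combine[OF _ _ left right] by simp
  \<comment> \<open>The dominant term \<open>2 * exp \<zeta> / \<zeta>\<^sup>2\<close> comes from
    the endpoint 1/2: there \<open>exp (\<zeta> / 2)\<close> cancels the decaying exponential and
    the linear part of \<open>G\<close> vanishes.\<close>
  have G: "exp \<zeta> * (G 1 - G (1/2)) = 2 * exp \<zeta> / \<zeta>\<^sup>2 - exp (\<zeta> / 2) * (1 / \<zeta> + 2 / \<zeta>\<^sup>2)"
  proof -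
    have "exp \<zeta> * G 1 = - (exp (\<zeta> / 2) * (1 / \<zeta> + 2 / \<zeta>\<^sup>2))"
      by (simp add: G_def exp_minus)
    moreover have "exp \<zeta> * G (1/2) = - (2 * exp \<zeta> / \<zeta>\<^sup>2)"
      by (simp add: G_def exp_minus)
    ultimately show ?thesis
      by (simp add: right_diff_distrib)
  qed
  show ?thesis
  proof (rule that[of f])
    show f0: "ev f 0 = 0" and f12: "ev f (1/2) = 0"
      by (simp_all add: f)
    then show "f \<in> E_space"
      by (simp add: E_space_iff)
    show "K (of_real \<zeta>) f (1/2) = 0"
      using integral_unique[OF left] by (simp add: K_def)
    show "K (of_real \<zeta>) f 1 = of_real (2 * exp \<zeta> / \<zeta>\<^sup>2 - exp (\<zeta> / 2) * (1 / \<zeta> + 2 / \<zeta>\<^sup>2))"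
      unfolding G[symmetric] K_def integral_unique[OF whole] by (simp add: exp_of_real[symmetric])
    show "norm f = exp (\<zeta> / 2)"
    proof (rule antisym)
      show "norm f \<le> exp (\<zeta> / 2)"
        by (rule norm_C01_le) (auto simp: f norm_mult mult_left_le)
      show "exp (\<zeta> / 2) \<le> norm f"
        using cmod_ev_le[of f 1] by (simp add: f)
    qed
  qed
qed

text \<open>Since \<open>K\<close> vanishes at 1/2 for the ramp, the exponential term of the
  resolvent formula drops out and only \<open>- K\<close> remains.\<close>

lemma resolvent_growth:
  fixes \<zeta> :: real
  assumes \<zeta>: "\<zeta> > 0"
  obtains f where "f \<in> E_space" "ev f 0 = 0" "ev f (1/2) = 0" "norm f = exp (\<zeta> / 2)"
    "K (of_real \<zeta>) f (1/2) = 0"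
    "\<And>x. x \<in> {0..1} \<Longrightarrow> ev (R\<^sub>T (of_real \<zeta>) f) x = - K (of_real \<zeta>) f x"
    "ev (R\<^sub>T (of_real \<zeta>) f) 1 =
      of_real (exp (\<zeta> / 2) * (1 / \<zeta> + 2 / \<zeta>\<^sup>2) - 2 * exp \<zeta> / \<zeta>\<^sup>2)"
proof -
  obtain f where f: "f \<in> E_space" "ev f 0 = 0" "ev f (1/2) = 0" "norm f = exp (\<zeta> / 2)"
    "K (of_real \<zeta>) f (1/2) = 0"
    "K (of_real \<zeta>) f 1 = of_real (2 * exp \<zeta> / \<zeta>\<^sup>2 - exp (\<zeta> / 2) * (1 / \<zeta> + 2 / \<zeta>\<^sup>2))"
    using ramp_exists[OF \<zeta>] by blast
  have R: "ev (R\<^sub>T (of_real \<zeta>) f) x = - K (of_real \<zeta>) f x" if "x \<in> {0..1}" for x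
    using resolvent_formula[OF f(1) pos_in_resolvent_set[OF \<zeta>] that] f(5) by simp
  show ?thesis
    using that[OF f(1-5) R] R[of 1] f(6) by simp
qed

text \<open>Test the operator norm on the ramp: bound the norm of its image below by the modulus at
  1, then divide by \<open>norm f = exp (\<zeta> / 2)\<close>.\<close>

lemma onorm_resolvent_ge:
  fixes \<zeta> :: real
  assumes \<zeta>: "\<zeta> > 0"
  shows "onorm_on E_space (R\<^sub>T (of_real \<zeta>)) \<ge> 2 * exp (\<zeta> / 2) / \<zeta>\<^sup>2 - 1 / \<zeta> - 2 / \<zeta>\<^sup>2"
proof -
  obtain f where f: "f \<in> E_space" "norm f = exp (\<zeta> / 2)" "ev (R\<^sub>T (of_real \<zeta>) f) 1 =
      of_real (exp (\<zeta> / 2) * (1 / \<zeta> + 2 / \<zeta>\<^sup>2) - 2 * exp \<zeta> / \<zeta>\<^sup>2)"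
    using resolvent_growth[OF \<zeta>] by blast
  obtain C where C: "\<And>f. f \<in> E_space \<Longrightarrow> norm (R\<^sub>T (of_real \<zeta>) f) \<le> C * norm f"
    using resolvent_bounded[OF pos_in_resolvent_set[OF \<zeta>]] by blast
  have sq: "exp (\<zeta> / 2) * exp (\<zeta> / 2) = exp \<zeta>"
    by (simp add: exp_add[symmetric])
  have "(2 * exp (\<zeta> / 2) / \<zeta>\<^sup>2 - 1 / \<zeta> - 2 / \<zeta>\<^sup>2) * exp (\<zeta> / 2)
      = 2 * exp \<zeta> / \<zeta>\<^sup>2 - exp (\<zeta> / 2) * (1 / \<zeta> + 2 / \<zeta>\<^sup>2)"
    unfolding sq[symmetric] by (simp add: algebra_simps)
  \<comment> \<open>The left side is minus the real number in \<open>f(3)\<close>, and an absolute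
    value dominates the negative of its argument.\<close>
  also have "\<dots> \<le> cmod (ev (R\<^sub>T (of_real \<zeta>) f) 1)"
    unfolding f(3) norm_of_real by (rule order_trans[OF _ abs_ge_minus_self]) simp
  also have "\<dots> \<le> norm (R\<^sub>T (of_real \<zeta>) f)"
    by (rule cmod_ev_le)
  finally have "2 * exp (\<zeta> / 2) / \<zeta>\<^sup>2 - 1 / \<zeta> - 2 / \<zeta>\<^sup>2 \<le> norm (R\<^sub>T (of_real \<zeta>) f) / norm f"
    unfolding f(2) by (subst pos_le_divide_eq) auto
  also have "\<dots> \<le> onorm_on E_space (R\<^sub>T (of_real \<zeta>))"
    using C f(1) by (rule onorm_on_ge)
  finally show ?thesis .
qed

text \<open>The lower bound already diverges, as \<open>exp (\<zeta> / 2)\<close> outgrows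
  \<open>\<zeta>\<^sup>2\<close> while the subtracted terms tend to 0.\<close>

lemma onorm_resolvent_at_top:
  "filterlim (\<lambda>\<zeta>::real. onorm_on E_space (R\<^sub>T (of_real \<zeta>))) at_top at_top"
proof (rule filterlim_at_top_mono)
  show "filterlim (\<lambda>\<zeta>::real. 2 * exp (\<zeta> / 2) / \<zeta>\<^sup>2 - 1 / \<zeta> - 2 / \<zeta>\<^sup>2) at_top at_top"
    by real_asymp
  show "\<forall>\<^sub>F \<zeta> in at_top. 2 * exp (\<zeta> / 2) / \<zeta>\<^sup>2 - 1 / \<zeta> - 2 / \<zeta>\<^sup>2
      \<le> onorm_on E_space (R\<^sub>T (complex_of_real \<zeta>))"
    using eventually_gt_at_top[of 0] by eventually_elim (rule onorm_resolvent_ge)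
qed

theorem mainTheorem3:
  shows "closed E_space
    \<and> closed_operator E_space F_space deriv01
    \<and> \<sigma>\<^sub>T = {4 * \<i> * of_real pi * of_int n | n :: int. True}
    \<and> (\<forall>f\<in>E_space. \<forall>\<zeta>\<in>\<rho>\<^sub>T. \<forall>x\<in>{0..1::real}.
         ev (R\<^sub>T \<zeta> f) x = exp (\<zeta> * of_real x) / (exp (\<zeta> / 2) - 1) * K \<zeta> f (1/2) - K \<zeta> f x)
    \<and> (\<forall>\<zeta>::real. \<zeta> > 0 \<longrightarrow> complex_of_real \<zeta> \<in> \<rho>\<^sub>T \<and>
         (\<exists>f\<in>E_space.
            ev f 0 = 0 \<and> ev f (1/2) = 0
          \<and> norm f = exp (\<zeta> / 2)
          \<and> K (of_real \<zeta>) f (1/2) = 0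
          \<and> (\<forall>x\<in>{0..1::real}. ev (R\<^sub>T (of_real \<zeta>) f) x = - K (of_real \<zeta>) f x)
          \<and> ev (R\<^sub>T (of_real \<zeta>) f) 1 =
              of_real (exp (\<zeta> / 2) * (1 / \<zeta> + 2 / \<zeta>\<^sup>2) - 2 * exp \<zeta> / \<zeta>\<^sup>2)))
    \<and> (\<forall>\<zeta>::real. \<zeta> > 0 \<longrightarrow>
         onorm_on E_space (R\<^sub>T (of_real \<zeta>)) \<ge> 2 * exp (\<zeta> / 2) / \<zeta>\<^sup>2 - 1 / \<zeta> - 2 / \<zeta>\<^sup>2)
    \<and> filterlim (\<lambda>\<zeta>::real. onorm_on E_space (R\<^sub>T (of_real \<zeta>))) at_top at_top"
proof (intro conjI allI impI ballI)
  fix \<zeta> :: real assume "\<zeta> > 0"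
  from resolvent_growth[OF this] show "\<exists>f\<in>E_space.
            ev f 0 = 0 \<and> ev f (1/2) = 0
          \<and> norm f = exp (\<zeta> / 2)
          \<and> K (of_real \<zeta>) f (1/2) = 0
          \<and> (\<forall>x\<in>{0..1::real}. ev (R\<^sub>T (of_real \<zeta>) f) x = - K (of_real \<zeta>) f x)
          \<and> ev (R\<^sub>T (of_real \<zeta>) f) 1 =
              of_real (exp (\<zeta> / 2) * (1 / \<zeta> + 2 / \<zeta>\<^sup>2) - 2 * exp \<zeta> / \<zeta>\<^sup>2)"
    by metis
qed (fact closed_E_space closed_operator_deriv01 spectrum_eq |
    rule resolvent_formula pos_in_resolvent_set onorm_resolvent_ge onorm_resolvent_at_top; assumption)+

end
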